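(* There is an absolute constant $K$ such that the following holds. Let $A,B$ be finite subsets of $\mathbb{R}$ and $\mathcal{P}:=A\times B$. Let $d,M\ge1$ and let $\mathcal{C}$ be a finite set of real algebraic curves in $\mathbb{R}^2$ of degree at most $d$ such that any two distinct points of $\mathcal{P}$ are contained in at most $M$ curves of $\mathcal{C}$. Assume that no curve in $\mathcal{C}$ contains a horizontal or vertical line, that $d^4|\mathcal{C}|\le M|\mathcal{P}|^2$, that $|A|\le|B|$, and that $d|\mathcal{C}|\ge M|B|^2/|A|$. Then $$|I(\mathcal{P},\mathcal{C})|\le K\, d^{2/3}M^{1/3}|\mathcal{P}|^{2/3}|\mathcal{C}|^{2/3}.$$
   Context: $I(\mathcal{P},\mathcal{C}):=\{(p,C)\in\mathcal{P}\times\mathcal{C}:p\in C\}$. A real algebraic curve in $\mathbb{R}^2$ is a real variety $Z_{\mathbb{R}^2}(f)=\{(x,y)\in\mathbb{R}^2: f(x,y)=0\}$, $f\in\mathbb{R}[x,y]$, of real dimension $1$ (isolated points allowed); its degree is the minimum degree of a polynomial $f$ with $C=Z_{\mathbb{R}^2}(f)$. *)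

theory Defs
  imports Complex_Main
begin

text \<open>Bivariate real polynomials, represented by their coefficient function
  (i,j) \<mapsto> coefficient of x^i y^j, together with a bound on the total degree.\<close>

definition poly2_deg_le :: "(nat \<times> nat \<Rightarrow> real) \<Rightarrow> nat \<Rightarrow> bool" where
  "poly2_deg_le c n \<longleftrightarrow> (\<forall>i j. n < i + j \<longrightarrow> c (i, j) = 0)"

definition poly2_eval :: "(nat \<times> nat \<Rightarrow> real) \<Rightarrow> nat \<Rightarrow> real \<times> real \<Rightarrow> real" where
  "poly2_eval c n p = (\<Sum>i\<le>n. \<Sum>j\<le>n. c (i, j) * fst p ^ i * snd p ^ j)"

definition zero_set2 :: "(nat \<times> nat \<Rightarrow> real) \<Rightarrow> nat \<Rightarrow> (real \<times> real) set" where
  "zero_set2 c n = {p. poly2_eval c n p = 0}"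

text \<open>A real algebraic set in R^2 has real dimension 1 iff it is infinite and not
  the whole plane (dimension 0 = finite, dimension 2 = the plane).\<close>
definition real_dim_one :: "(real \<times> real) set \<Rightarrow> bool" where
  "real_dim_one C \<longleftrightarrow> infinite C \<and> C \<noteq> UNIV"

definition alg_curve_deg_le :: "nat \<Rightarrow> (real \<times> real) set \<Rightarrow> bool" where
  "alg_curve_deg_le d C \<longleftrightarrow>
     (\<exists>c. poly2_deg_le c d \<and> C = zero_set2 c d) \<and> real_dim_one C"

definition contains_axis_line :: "(real \<times> real) set \<Rightarrow> bool" where
  "contains_axis_line C \<longleftrightarrow>
     (\<exists>b. \<forall>x. (x, b) \<in> C) \<or> (\<exists>a. \<forall>y. (a, y) \<in> C)"

definition incidences :: "(real \<times> real) set \<Rightarrow> (real \<times> real) set set \<Rightarrow> ((real \<times> real) \<times> (real \<times> real) set) set" where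
  "incidences P \<C> = {(p, C). p \<in> P \<and> C \<in> \<C> \<and> p \<in> C}"

end

theory Submission
  imports Defs "HOL-Analysis.Analysis"
begin

text \<open>
  Cut \<open>A\<close> and \<open>B\<close> into \<open>k\<close> consecutive blocks of nearly equal size, which groups \<open>A \<times> B\<close> into
  \<open>k\<^sup>2\<close> disjoint rectangular cells. A curve of degree \<open>d\<close> meets \<open>O(k d + d\<^sup>2)\<close> cells: it has at
  most \<open>d\<close> points on each of the \<open>O(k)\<close> lines bounding the cells, and every cell that it meets
  only in the interior contains a critical point of \<open>f + \<epsilon> (x\<^bsup>d+1\<^esup> + y\<^bsup>d+1\<^esup>)\<close>. The
  critical points of this perturbation satisfy equations expressing \<open>x\<^bsup>d\<^esup>\<close> and \<open>y\<^bsup>d\<^esup>\<close> by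
  polynomials of lower degree, so the \<open>d\<^sup>2\<close> monomials with both exponents below \<open>d\<close> span all
  functions on them, and there are at most \<open>d\<^sup>2\<close> of them; this replaces Bezout and Harnack.

  In each cell that it meets, a curve has one incidence plus further ones, which are paid for by
  pairs of points in the same cell; a pair is used by at most \<open>M\<close> curves. Hence the number of
  incidences is \<open>O((k d + d\<^sup>2) |C| + M |P|\<^sup>2 / k\<^sup>2)\<close>. Both terms balance for
  \<open>k\<^sup>3 \<approx> M |P|\<^sup>2 / (d |C|)\<close>, and the two numerical hypotheses say \<open>d \<le> k \<le> |A|\<close>.
\<close>

section \<open>Counting points through linear relations between monomials\<close>

text \<open>Gaussian elimination, by induction on the equations: one equation is solved for an
  unknown \<open>s0\<close> with nonzero coefficient, and substituting the solution leaves one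
  equation and one unknown fewer. Below, the equations are monomials and the unknowns are weights on
  points.\<close>

lemma nontrivial_linear_relation:
  fixes \<phi> :: "'e \<Rightarrow> 's \<Rightarrow> real"
  assumes "finite E" "finite S" "card E < card S"
  shows "\<exists>w. (\<exists>s\<in>S. w s \<noteq> 0) \<and> (\<forall>e\<in>E. (\<Sum>s\<in>S. w s * \<phi> e s) = 0)"
  using assms
proof (induction E arbitrary: S \<phi> rule: finite_induct)
  case empty
  then have "S \<noteq> {}" by auto
  then show ?case by (intro exI[of _ "\<lambda>_. 1"]) auto
next
  case (insert e E)
  show ?case
  proof (cases "\<forall>s\<in>S. \<phi> e s = 0")
    case True
    have "card E < card S" using insert by auto
    then obtain w where "\<exists>s\<in>S. w s \<noteq> 0" "\<forall>e\<in>E. (\<Sum>s\<in>S. w s * \<phi> e s) = 0"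
      using insert.IH[OF insert.prems(1)] by blast
    with True show ?thesis by (intro exI[of _ w]) auto
  next
    case False
    then obtain s0 where s0: "s0 \<in> S" "\<phi> e s0 \<noteq> 0" by blast
    define T where "T = S - {s0}"
    have T: "finite T" "s0 \<notin> T" "S = insert s0 T" using insert.prems s0 by (auto simp: T_def)
    have "card E < card T" using insert T by auto
    then obtain w where w: "\<exists>s\<in>T. w s \<noteq> 0"
      "\<And>e'. e' \<in> E \<Longrightarrow> (\<Sum>s\<in>T. w s * (\<phi> e' s - \<phi> e' s0 * \<phi> e s / \<phi> e s0)) = 0"
      using insert.IH[OF T(1), of "\<lambda>e' s. \<phi> e' s - \<phi> e' s0 * \<phi> e s / \<phi> e s0"] by blast
    define t where "t = - (\<Sum>s\<in>T. w s * \<phi> e s) / \<phi> e s0"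
    define v where "v = (\<lambda>s. if s = s0 then t else w s)"
    have v: "(\<Sum>s\<in>S. v s * \<phi> e' s) = t * \<phi> e' s0 + (\<Sum>s\<in>T. w s * \<phi> e' s)" for e'
    proof -
      have "(\<Sum>s\<in>T. v s * \<phi> e' s) = (\<Sum>s\<in>T. w s * \<phi> e' s)"
        using T(2) by (intro sum.cong) (auto simp: v_def)
      then show ?thesis using T by (simp add: v_def)
    qed
    have "(\<Sum>s\<in>S. v s * \<phi> e s) = 0" using s0 by (simp add: v t_def)
    moreover have "(\<Sum>s\<in>S. v s * \<phi> e' s) = 0" if "e' \<in> E" for e'
    proof -
      have "(\<Sum>s\<in>T. w s * (\<phi> e' s - \<phi> e' s0 * \<phi> e s / \<phi> e s0))
        = (\<Sum>s\<in>T. w s * \<phi> e' s) - (\<Sum>s\<in>T. w s * \<phi> e s) * (\<phi> e' s0 / \<phi> e s0)"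
        unfolding sum_distrib_right sum_subtractf[symmetric]
        by (intro sum.cong) (simp_all add: algebra_simps)
      then show ?thesis using w(2)[OF that] by (simp add: v t_def)
    qed
    moreover have "\<exists>s\<in>S. v s \<noteq> 0" using w(1) T by (auto simp: v_def)
    ultimately show ?thesis by blast
  qed
qed

text \<open>With more than \<open>n^2\<close> points, some nonzero weight \<open>w\<close> on them
  annihilates the \<open>n^2\<close> monomials with both exponents below \<open>n\<close>. The
  hypotheses rewrite \<open>x^n\<close> and \<open>y^n\<close> in lower total degree, so
  \<open>w\<close> annihilates every monomial, which is absurd for points that polynomials can
  separate. The degree condition concerns only nonzero coefficients, so that a full square of
  exponents can serve as index set for a polynomial of bounded total degree.\<close>

lemma card_common_zeros_le:
  fixes S :: "(real \<times> real) set" and u v :: "'j \<Rightarrow> real" and i k i' k' :: "'j \<Rightarrow> nat"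
  assumes "finite S" "finite J"
    and x: "\<And>p. p \<in> S \<Longrightarrow> fst p ^ n = (\<Sum>j\<in>J. u j * (fst p ^ i j * snd p ^ k j))"
    and y: "\<And>p. p \<in> S \<Longrightarrow> snd p ^ n = (\<Sum>j\<in>J. v j * (fst p ^ i' j * snd p ^ k' j))"
    and u: "\<And>j. j \<in> J \<Longrightarrow> u j \<noteq> 0 \<Longrightarrow> i j + k j < n"
    and v: "\<And>j. j \<in> J \<Longrightarrow> v j \<noteq> 0 \<Longrightarrow> i' j + k' j < n"
  shows "card S \<le> n\<^sup>2"
proof (rule ccontr)
  assume "\<not> card S \<le> n\<^sup>2"
  then have "card ({..<n} \<times> {..<n}) < card S" by (simp add: power2_eq_square)
  from nontrivial_linear_relation[OF _ \<open>finite S\<close> this, of "\<lambda>e p. fst p ^ fst e * snd p ^ snd e"]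
  obtain w where w: "\<exists>s\<in>S. w s \<noteq> 0"
    "\<And>a b. a < n \<Longrightarrow> b < n \<Longrightarrow> (\<Sum>p\<in>S. w p * (fst p ^ a * snd p ^ b)) = 0"
    by auto
  have mono: "(\<Sum>p\<in>S. w p * (fst p ^ a * snd p ^ b)) = 0" for a b
  proof (induction "a + b" arbitrary: a b rule: less_induct)
    case less
    consider "a < n" "b < n" | "a \<ge> n" | "b \<ge> n" by linarith
    then show ?case
    proof cases
      case 1
      then show ?thesis by (rule w(2))
    next
      case 2
      then obtain a' where a: "a = n + a'" using le_Suc_ex by blast
      have "(\<Sum>p\<in>S. w p * (fst p ^ a * snd p ^ b))
        = (\<Sum>p\<in>S. \<Sum>j\<in>J. u j * (w p * (fst p ^ (i j + a') * snd p ^ (k j + b))))"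
        by (intro sum.cong refl) (simp add: a power_add x sum_distrib_left sum_distrib_right mult_ac)
      also have "\<dots> = (\<Sum>j\<in>J. u j * (\<Sum>p\<in>S. w p * (fst p ^ (i j + a') * snd p ^ (k j + b))))"
        by (subst sum.swap) (simp add: sum_distrib_left)
      \<comment> \<open>If \<open>u j\<close> is nonzero, replacing \<open>x^n\<close> by the
        \<open>j\<close>-th monomial lowers the total degree, so the induction hypothesis applies to
        the inner sum.\<close>
      also have "\<dots> = 0"
        using u by (intro sum.neutral ballI) (fastforce simp: a intro!: less)
      finally show ?thesis .
    next
      case 3
      then obtain b' where b: "b = n + b'" using le_Suc_ex by blast
      have "(\<Sum>p\<in>S. w p * (fst p ^ a * snd p ^ b))
        = (\<Sum>p\<in>S. \<Sum>j\<in>J. v j * (w p * (fst p ^ (i' j + a) * snd p ^ (k' j + b'))))"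
        by (intro sum.cong refl) (simp add: b power_add y sum_distrib_left sum_distrib_right mult_ac)
      also have "\<dots> = (\<Sum>j\<in>J. v j * (\<Sum>p\<in>S. w p * (fst p ^ (i' j + a) * snd p ^ (k' j + b'))))"
        by (subst sum.swap) (simp add: sum_distrib_left)
      also have "\<dots> = 0"
        using v by (intro sum.neutral ballI) (fastforce simp: b intro!: less)
      finally show ?thesis .
    qed
  qed
  text \<open>The functional \<open>w\<close> annihilates all polynomials, hence also one that vanishes on
    \<open>S\<close> except at a single point.\<close>
  define D where "D = (\<lambda>p q :: real \<times> real. (fst p - fst q)\<^sup>2 + (snd p - snd q)\<^sup>2)"
  have prod: "(\<Sum>p\<in>S. w p * ((\<Prod>q\<in>Q. D p q) * (fst p ^ a * snd p ^ b))) = 0"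
    if "finite Q" for Q a b
    using that
  proof (induction Q arbitrary: a b rule: finite_induct)
    case empty
    then show ?case by (simp add: mono)
  next
    case (insert q Q)
    \<comment> \<open>Expanding the new factor \<open>D p q\<close> in the coordinates of
      \<open>p\<close> shifts the exponents by at most two. The sum is thus a combination of
      instances of the induction hypothesis, which is why \<open>a\<close> and \<open>b\<close> are
      arbitrary.\<close>
    define G where "G = (\<lambda>a b. (\<Sum>p\<in>S. w p * ((\<Prod>q\<in>Q. D p q) * (fst p ^ a * snd p ^ b))))"
    have "(\<Sum>p\<in>S. w p * ((\<Prod>q\<in>insert q Q. D p q) * (fst p ^ a * snd p ^ b)))
      = G (a + 2) b - 2 * fst q * G (a + 1) b + (fst q)\<^sup>2 * G a b
        + G a (b + 2) - 2 * snd q * G a (b + 1) + (snd q)\<^sup>2 * G a b"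
      unfolding G_def sum_distrib_left sum.distrib[symmetric] sum_subtractf[symmetric]
      by (intro sum.cong refl)
        (simp add: insert.hyps, simp add: D_def power2_eq_square algebra_simps)
    then show ?case by (simp add: G_def insert.IH)
  qed
  obtain s where s: "s \<in> S" "w s \<noteq> 0" using w by blast
  have "(\<Sum>p\<in>S. w p * (\<Prod>q\<in>S - {s}. D p q)) = 0"
    using prod[of "S - {s}" 0 0] \<open>finite S\<close> by simp
  moreover have "(\<Sum>p\<in>S. w p * (\<Prod>q\<in>S - {s}. D p q)) = w s * (\<Prod>q\<in>S - {s}. D s q)"
  proof -
    have "(\<Sum>p\<in>S - {s}. w p * (\<Prod>q\<in>S - {s}. D p q)) = 0"
      using \<open>finite S\<close> by (intro sum.neutral ballI) (auto simp: D_def)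
    then show ?thesis using \<open>finite S\<close> s by (simp add: sum.remove)
  qed
  moreover have "(\<Prod>q\<in>S - {s}. D s q) \<noteq> 0"
    using \<open>finite S\<close> by (auto simp: D_def sum_power2_eq_zero_iff prod_eq_iff)
  ultimately show False using s by simp
qed

section \<open>Counting incidences cell by cell, and cutting a set of reals into blocks\<close>

text \<open>On each curve, one representative point is set aside in every cell that contains a point
  of the curve, at most \<open>N\<close> in all. Every other point is charged to the pair formed
  with the representative of its cell. Summing over the curves and exchanging the sums counts each
  pair at most \<open>M\<close> times, and there are at most \<open>card P * L\<close> ordered pairs
  inside cells.\<close>

lemma incidences_le_cells:
  fixes P :: "(real \<times> real) set" and \<kappa> :: "real \<times> real \<Rightarrow> 'c"
  assumes "finite P" "finite \<C>"
    and M: "\<And>p q. p \<in> P \<Longrightarrow> q \<in> P \<Longrightarrow> p \<noteq> q \<Longrightarrow> card {C\<in>\<C>. p \<in> C \<and> q \<in> C} \<le> M"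
    and N: "\<And>C. C \<in> \<C> \<Longrightarrow> card (\<kappa> ` (P \<inter> C)) \<le> N"
    and L: "\<And>i. card {p\<in>P. \<kappa> p = i} \<le> L"
  shows "card (incidences P \<C>) \<le> N * card \<C> + M * (card P * L)"
proof -
  define D where "D = {(p, q). p \<in> P \<and> q \<in> P \<and> \<kappa> q = \<kappa> p \<and> p \<noteq> q}"
  have finD: "finite D"
    by (rule finite_subset[of _ "P \<times> P"]) (auto simp: D_def \<open>finite P\<close>)
  have one: "card (P \<inter> C) \<le> N + card {e\<in>D. fst e \<in> C \<and> snd e \<in> C}" if "C \<in> \<C>" for C
  proof -
    define rep where "rep = inv_into (P \<inter> C) \<kappa>"
    define R where "R = rep ` \<kappa> ` (P \<inter> C)"
    have rep: "rep (\<kappa> p) \<in> P \<inter> C" "\<kappa> (rep (\<kappa> p)) = \<kappa> p" if "p \<in> P \<inter> C" for p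
      unfolding rep_def using that by (rule inv_into_into[OF imageI], intro f_inv_into_f imageI that)
    \<comment> \<open>The second component recovers \<open>q\<close>, so charging is injective; as
      \<open>q\<close> is not in \<open>R\<close>, the two components differ and the pair lies in
      \<open>D\<close>.\<close>
    have "card (P \<inter> C - R) = card ((\<lambda>q. (rep (\<kappa> q), q)) ` (P \<inter> C - R))"
      by (intro card_image[symmetric] inj_onI) simp
    also have "\<dots> \<le> card {e\<in>D. fst e \<in> C \<and> snd e \<in> C}"
      using finD rep by (intro card_mono) (auto simp: D_def R_def)
    finally have "card (P \<inter> C - R) \<le> \<dots>" .
    moreover have "card R \<le> N"
      unfolding R_def using \<open>finite P\<close> N[OF that] by (meson card_image_le finite_Int finite_imageI order_trans)
    moreover have "card (P \<inter> C) \<le> card R + card (P \<inter> C - R)"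
    proof -
      have "card (P \<inter> C) \<le> card (R \<union> (P \<inter> C - R))"
        using \<open>finite P\<close> by (intro card_mono) (auto simp: R_def)
      then show ?thesis using card_Un_le order_trans by blast
    qed
    ultimately show ?thesis by linarith
  qed
  have "incidences P \<C> = prod.swap ` (SIGMA C:\<C>. P \<inter> C)"
    by (auto simp: incidences_def image_iff)
  then have "card (incidences P \<C>) = card (SIGMA C:\<C>. P \<inter> C)"
    by (simp add: card_image)
  also have "\<dots> = (\<Sum>C\<in>\<C>. card (P \<inter> C))"
    using \<open>finite P\<close> \<open>finite \<C>\<close> by simp
  also have "\<dots> \<le> (\<Sum>C\<in>\<C>. N + card {e\<in>D. fst e \<in> C \<and> snd e \<in> C})"
    by (intro sum_mono one)
  also have "\<dots> = N * card \<C> + (\<Sum>C\<in>\<C>. card {e\<in>D. fst e \<in> C \<and> snd e \<in> C})"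
    by (simp add: sum.distrib)
  also have "(\<Sum>C\<in>\<C>. card {e\<in>D. fst e \<in> C \<and> snd e \<in> C})
      = (\<Sum>e\<in>D. card {C\<in>\<C>. fst e \<in> C \<and> snd e \<in> C})"
    using sum.swap_restrict[OF \<open>finite \<C>\<close> finD, of "\<lambda>_ _. 1::nat" "\<lambda>C e. fst e \<in> C \<and> snd e \<in> C"]
    by simp
  also have "\<dots> \<le> (\<Sum>e\<in>D. M)"
    by (intro sum_mono) (auto simp: D_def intro: M)
  also have "\<dots> = M * card D" by simp
  also have "card D \<le> card (SIGMA p:P. {q\<in>P. \<kappa> q = \<kappa> p})"
    using \<open>finite P\<close> by (intro card_mono) (auto simp: D_def)
  also have "\<dots> \<le> card P * L"
    using \<open>finite P\<close> L sum_mono[of P "\<lambda>p. card {q\<in>P. \<kappa> q = \<kappa> p}" "\<lambda>_. L"] by simp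
  finally show ?thesis by simp
qed

text \<open>The label of a point is its rank in \<open>A\<close> divided by the block length, and
  \<open>lo\<close> and \<open>hi\<close> are the extreme elements of a block. Labels below
  \<open>k\<close> may be left without points, so the separation of blocks is claimed only for
  labels in the image.\<close>

lemma order_convex_partition:
  fixes A :: "real set"
  assumes "finite A" "1 \<le> k" "k \<le> card A"
  obtains \<kappa> :: "real \<Rightarrow> nat" and lo hi :: "nat \<Rightarrow> real" where
    "\<kappa> ` A \<subseteq> {..<k}"
    "\<And>a. a \<in> A \<Longrightarrow> lo (\<kappa> a) \<le> a \<and> a \<le> hi (\<kappa> a)"
    "\<And>i j. i \<in> \<kappa> ` A \<Longrightarrow> j \<in> \<kappa> ` A \<Longrightarrow> i < j \<Longrightarrow> hi i < lo j"
    "\<And>i. card {a\<in>A. \<kappa> a = i} * k \<le> 2 * card A"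
proof -
  \<comment> \<open>This is \<open>card A / k\<close> rounded up: large enough for \<open>k\<close>
    blocks to cover \<open>A\<close>, while rounding costs at most a factor 2 because
    \<open>k\<close> is at most \<open>card A\<close>.\<close>
  define m where "m = (card A + k - 1) div k"
  have m: "m * k \<le> 2 * card A" "card A \<le> m * k"
  proof -
    have "m * k \<le> card A + k - 1" by (simp add: m_def)
    then show "m * k \<le> 2 * card A" using assms by linarith
    have "card A + k - 1 < m * k + k"
      using assms dividend_less_div_times[of k "card A + k - 1"] by (simp add: m_def)
    then show "card A \<le> m * k" by linarith
  qed
  define rank where "rank = (\<lambda>a. card {x\<in>A. x < a})"
  have rank_less: "rank a < rank b" if "a \<in> A" "a < b" for a b
    unfolding rank_def using that \<open>finite A\<close> by (intro psubset_card_mono) auto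
  have rank_bound: "rank a < card A" if "a \<in> A" for a
    unfolding rank_def using that \<open>finite A\<close> by (intro psubset_card_mono) auto
  have "inj_on rank A"
    by (intro linorder_inj_onI) (use rank_less in \<open>force+\<close>)
  define \<kappa> where "\<kappa> = (\<lambda>a. rank a div m)"
  define F where "F = (\<lambda>i. {a\<in>A. \<kappa> a = i})"
  have F: "finite (F i)" for i using \<open>finite A\<close> by (simp add: F_def)
  have less: "a < b" if "a \<in> A" "b \<in> A" "\<kappa> a < \<kappa> b" for a b
  proof (rule ccontr)
    assume "\<not> a < b"
    then have "rank b \<le> rank a" using rank_less[of b a] that by (cases "a = b") auto
    then have "\<kappa> b \<le> \<kappa> a" by (simp add: \<kappa>_def div_le_mono)
    then show False using that by simp
  qed
  show ?thesis
  proof (rule that[of \<kappa> "\<lambda>i. Min (F i)" "\<lambda>i. Max (F i)"])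
    show "\<kappa> ` A \<subseteq> {..<k}"
      using rank_bound m by (auto simp: \<kappa>_def intro!: less_mult_imp_div_less) (metis less_le_trans mult.commute)
    show "Min (F (\<kappa> a)) \<le> a \<and> a \<le> Max (F (\<kappa> a))" if "a \<in> A" for a
      using that F by (auto simp: F_def)
    show "Max (F i) < Min (F j)" if "i \<in> \<kappa> ` A" "j \<in> \<kappa> ` A" "i < j" for i j
    proof -
      have "F i \<noteq> {}" "F j \<noteq> {}" using that by (auto simp: F_def)
      then have "Max (F i) \<in> F i" "Min (F j) \<in> F j" using F by auto
      then show ?thesis using less that by (auto simp: F_def)
    qed
    show "card {a\<in>A. \<kappa> a = i} * k \<le> 2 * card A" for i
    proof -
      have "card (F i) = card (rank ` F i)"
        using \<open>inj_on rank A\<close> by (intro card_image[symmetric]) (auto simp: F_def inj_on_def)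
      also have "\<dots> \<le> card {i * m..<i * m + m}"
      proof (intro card_mono subsetI)
        fix t assume "t \<in> rank ` F i"
        then have "t div m = i" "t < card A" using rank_bound by (auto simp: F_def \<kappa>_def)
        moreover have "m > 0" using m \<open>t < card A\<close> by (cases m) auto
        ultimately show "t \<in> {i * m..<i * m + m}"
          using dividend_less_div_times[of m t] by auto
      qed simp
      also have "\<dots> = m" by simp
      finally have "card (F i) \<le> m" .
      then have "card (F i) * k \<le> m * k" by (rule mult_le_mono1)
      also note m(1)
      finally show ?thesis by (simp only: F_def)
    qed
  qed
qed

section \<open>Interior extrema of perturbed functions on rectangles\<close>

text \<open>By compactness, \<open>f\<close> is at least some \<open>\<delta> > 0\<close> on the
  boundary and \<open>\<bar>g\<bar>\<close> is bounded by some \<open>\<beta>\<close> on the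
  rectangle. Once \<open>\<epsilon> * \<beta> < \<delta> / 2\<close>, the perturbed function is
  below \<open>\<delta> / 2\<close> at \<open>z\<close> and above it on the boundary. The conclusion
  holds for all small \<open>\<epsilon>\<close>, so that finitely many rectangles can later share
  one value.\<close>

lemma perturbed_minimum_in_interior:
  fixes f g :: "real \<times> real \<Rightarrow> real"
  assumes f: "continuous_on UNIV f" and g: "continuous_on UNIV g"
    and z: "z \<in> {a..b} \<times> {e..h}" "f z \<le> 0"
    and frame: "\<And>p. p \<in> {a, b} \<times> {e..h} \<union> {a..b} \<times> {e, h} \<Longrightarrow> f p > 0"
  shows "\<forall>\<^sub>F \<epsilon> in at_right 0. \<exists>p\<in>{a<..<b} \<times> {e<..<h}.
    \<forall>q\<in>{a..b} \<times> {e..h}. f p + \<epsilon> * g p \<le> f q + \<epsilon> * g q"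
proof -
  let ?R = "{a..b} \<times> {e..h}" and ?T = "{a, b} \<times> {e..h} \<union> {a..b} \<times> {e, h}"
  have R: "compact ?R" "?R \<noteq> {}" using z by (auto intro: compact_Times)
  have T: "compact ?T" "?T \<noteq> {}" using z by (auto intro!: compact_Times compact_Un)
  obtain p0 where p0: "p0 \<in> ?T" "\<And>p. p \<in> ?T \<Longrightarrow> f p0 \<le> f p"
    using continuous_attains_inf[OF T continuous_on_subset[OF f]] by blast
  define \<delta> where "\<delta> = f p0"
  have \<delta>: "\<delta> > 0" using frame p0 by (simp add: \<delta>_def)
  obtain q0 where q0: "\<And>q. q \<in> ?R \<Longrightarrow> \<bar>g q\<bar> \<le> \<bar>g q0\<bar>"
    using continuous_attains_sup[OF R, of "\<lambda>q. \<bar>g q\<bar>"] continuous_on_subset[OF g]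
    by (metis continuous_on_rabs subset_UNIV)
  \<comment> \<open>The summand 1 keeps \<open>\<beta>\<close> positive even if \<open>g\<close>
    vanishes on the rectangle.\<close>
  define \<beta> where "\<beta> = \<bar>g q0\<bar> + 1"
  have \<beta>: "\<beta> > 0" "\<And>q. q \<in> ?R \<Longrightarrow> \<bar>g q\<bar> \<le> \<beta>" using q0 by (force simp: \<beta>_def)+
  have "\<forall>\<^sub>F \<epsilon> in at_right 0. 0 < \<epsilon> \<and> \<epsilon> < \<delta> / (2 * \<beta>)"
    using \<delta> \<beta>(1) by (auto simp: eventually_at_right_field intro!: exI[of _ "\<delta> / (2 * \<beta>)"])
  then show ?thesis
  proof eventually_elim
    case (elim \<epsilon>)
    then have \<epsilon>: "\<epsilon> > 0" "\<epsilon> * \<beta> < \<delta> / 2" using \<beta> by (auto simp: field_simps)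
    have small: "\<bar>\<epsilon> * g q\<bar> < \<delta> / 2" if "q \<in> ?R" for q
    proof -
      have "\<bar>\<epsilon> * g q\<bar> \<le> \<epsilon> * \<beta>"
        using \<beta>(2)[OF that] \<epsilon> by (simp add: abs_mult)
      with \<epsilon> show ?thesis by linarith
    qed
    have "continuous_on ?R (\<lambda>q. f q + \<epsilon> * g q)"
      by (intro continuous_intros continuous_on_subset[OF f] continuous_on_subset[OF g]) auto
    from continuous_attains_inf[OF R this]
    obtain p where p: "p \<in> ?R" "\<And>q. q \<in> ?R \<Longrightarrow> f p + \<epsilon> * g p \<le> f q + \<epsilon> * g q" by blast
    have "p \<notin> ?T"
    proof
      assume "p \<in> ?T"
      then have "\<delta> \<le> f p" using p0 by (simp add: \<delta>_def)
      then show False using p(2)[OF z(1)] z(2) small[OF z(1)] small[OF p(1)] by linarith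
    qed
    then have "p \<in> {a<..<b} \<times> {e<..<h}" using p(1) by (cases p) auto
    then show ?case using p by blast
  qed
qed

lemma connected_nonzero_sign:
  fixes f :: "'a::topological_space \<Rightarrow> real"
  assumes "connected T" "continuous_on T f" "\<And>p. p \<in> T \<Longrightarrow> f p \<noteq> 0"
  shows "(\<forall>p\<in>T. f p > 0) \<or> (\<forall>p\<in>T. f p < 0)"
proof (rule ccontr)
  assume "\<not> ?thesis"
  then obtain p q where "p \<in> T" "q \<in> T" "f p \<le> 0" "f q \<ge> 0" by (auto simp: not_less)
  moreover have "connected (f ` T)" using assms by (intro connected_continuous_image)
  ultimately have "0 \<in> f ` T" by (meson connectedD_interval image_eqI)
  with assms(3) show False by auto
qed

text \<open>The four sides are added one at a time, each meeting the union of the earlier ones in a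
  corner.\<close>

lemma connected_frame:
  fixes a b e h :: real
  assumes "a \<le> b" "e \<le> h"
  shows "connected ({a, b} \<times> {e..h} \<union> {a..b} \<times> {e, h})"
proof -
  have "{a, b} \<times> {e..h} \<union> {a..b} \<times> {e, h}
    = ((({a} \<times> {e..h}) \<union> ({a..b} \<times> {e})) \<union> ({b} \<times> {e..h})) \<union> ({a..b} \<times> {h})"
    by auto
  moreover have "connected ({a} \<times> {e..h})" "connected ({a..b} \<times> {e})"
    "connected ({b} \<times> {e..h})" "connected ({a..b} \<times> {h})"
    by (simp_all add: connected_Times)
  moreover have "(a, e) \<in> ({a} \<times> {e..h}) \<inter> ({a..b} \<times> {e})"
    "(b, e) \<in> (({a} \<times> {e..h}) \<union> ({a..b} \<times> {e})) \<inter> ({b} \<times> {e..h})"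
    "(a, h) \<in> ((({a} \<times> {e..h}) \<union> ({a..b} \<times> {e})) \<union> ({b} \<times> {e..h})) \<inter> ({a..b} \<times> {h})"
    using assms by simp_all
  ultimately show ?thesis by (metis connected_Un empty_iff)
qed

text \<open>The boundary is connected and free of zeros, so \<open>f\<close> has constant sign
  there. A positive sign gives an interior minimum; a negative one gives an interior maximum, by
  passing to \<open>- f\<close> and \<open>- g\<close>.\<close>

lemma perturbed_extremum_in_interior:
  fixes f g :: "real \<times> real \<Rightarrow> real"
  assumes f: "continuous_on UNIV f" and g: "continuous_on UNIV g"
    and z: "z \<in> {a..b} \<times> {e..h}" "f z = 0"
    and frame: "\<And>p. p \<in> {a, b} \<times> {e..h} \<union> {a..b} \<times> {e, h} \<Longrightarrow> f p \<noteq> 0"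
  shows "\<forall>\<^sub>F \<epsilon> in at_right 0. \<exists>p\<in>{a<..<b} \<times> {e<..<h}.
    (\<forall>q\<in>{a..b} \<times> {e..h}. f p + \<epsilon> * g p \<le> f q + \<epsilon> * g q) \<or>
    (\<forall>q\<in>{a..b} \<times> {e..h}. f q + \<epsilon> * g q \<le> f p + \<epsilon> * g p)"
proof -
  let ?T = "{a, b} \<times> {e..h} \<union> {a..b} \<times> {e, h}"
  have "connected ?T" using z by (intro connected_frame) auto
  then consider "\<forall>p\<in>?T. f p > 0" | "\<forall>p\<in>?T. f p < 0"
    using connected_nonzero_sign[OF _ continuous_on_subset[OF f]] frame by blast
  then show ?thesis
  proof cases
    case 1
    then show ?thesis
      using perturbed_minimum_in_interior[OF f g z(1)] z(2) by (auto elim!: eventually_mono)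
  next
    case 2
    have "\<forall>\<^sub>F \<epsilon> in at_right 0. \<exists>p\<in>{a<..<b} \<times> {e<..<h}.
      \<forall>q\<in>{a..b} \<times> {e..h}. - f p + \<epsilon> * - g p \<le> - f q + \<epsilon> * - g q"
      using 2 z f g by (intro perturbed_minimum_in_interior[of _ _ z] continuous_intros) auto
    then show ?thesis
    proof eventually_elim
      case (elim \<epsilon>)
      then obtain p where "p \<in> {a<..<b} \<times> {e<..<h}"
        and p: "\<And>q. q \<in> {a..b} \<times> {e..h} \<Longrightarrow> - f p + \<epsilon> * - g p \<le> - f q + \<epsilon> * - g q" by blast
      moreover have "f q + \<epsilon> * g q \<le> f p + \<epsilon> * g p" if "q \<in> {a..b} \<times> {e..h}" for q
        using p[OF that] by simp
      ultimately show ?case by blast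
    qed
  qed
qed

lemma DERIV_interior_extremum:
  fixes \<phi> :: "real \<Rightarrow> real"
  assumes "DERIV \<phi> x :> l" "a < x" "x < b"
    and "(\<forall>t\<in>{a..b}. \<phi> x \<le> \<phi> t) \<or> (\<forall>t\<in>{a..b}. \<phi> t \<le> \<phi> x)"
  shows "l = 0"
  using assms(4)
proof
  assume *: "\<forall>t\<in>{a..b}. \<phi> x \<le> \<phi> t"
  show ?thesis
    by (rule DERIV_local_min[OF assms(1), of "min (x - a) (b - x)"])
      (use * assms in \<open>auto intro!: bspec[OF *]\<close>)
next
  assume *: "\<forall>t\<in>{a..b}. \<phi> t \<le> \<phi> x"
  show ?thesis
    by (rule DERIV_local_max[OF assms(1), of "min (x - a) (b - x)"])
      (use * assms in \<open>auto intro!: bspec[OF *]\<close>)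
qed

lemma continuous_on_poly2_eval: "continuous_on S (poly2_eval c n)"
  unfolding poly2_eval_def by (intro continuous_intros)

text \<open>Both partial derivatives vanish at an interior extremum. The perturbation contributes
  the pure powers \<open>\<epsilon> * Suc n * x^n\<close> and
  \<open>\<epsilon> * Suc n * y^n\<close>, for which the equations are solved; this is the shape
  required by \<open>card_common_zeros_le\<close>. Truncation in \<open>fst t - 1\<close> is
  harmless since the coefficient then contains the factor \<open>fst t = 0\<close>, and likewise for
  \<open>snd t\<close>.\<close>

lemma perturbed_extremum_equations:
  assumes p: "p \<in> {a<..<b} \<times> {e<..<h}" and "\<epsilon> > 0"
    and F: "F = (\<lambda>q. poly2_eval c n q + \<epsilon> * (fst q ^ Suc n + snd q ^ Suc n))"
    and ext: "(\<forall>q\<in>{a..b} \<times> {e..h}. F p \<le> F q) \<or> (\<forall>q\<in>{a..b} \<times> {e..h}. F q \<le> F p)"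
  shows "fst p ^ n = (\<Sum>t\<in>{..n} \<times> {..n}. (- (c t * fst t) / (\<epsilon> * Suc n))
      * (fst p ^ (fst t - 1) * snd p ^ snd t))"
    and "snd p ^ n = (\<Sum>t\<in>{..n} \<times> {..n}. (- (c t * snd t) / (\<epsilon> * Suc n))
      * (fst p ^ fst t * snd p ^ (snd t - 1)))"
proof -
  obtain x y where xy: "p = (x, y)" by fastforce
  have E: "\<epsilon> * Suc n \<noteq> 0" using \<open>\<epsilon> > 0\<close> by simp
  have solve: "X = (\<Sum>t\<in>I. (- u t / (\<epsilon> * Suc n)) * v t)"
    if "(\<Sum>t\<in>I. u t * v t) + \<epsilon> * Suc n * X = 0" for X and I :: "(nat \<times> nat) set" and u v
  proof -
    have "(\<Sum>t\<in>I. (- u t / (\<epsilon> * Suc n)) * v t) = - (\<Sum>t\<in>I. u t * v t) / (\<epsilon> * Suc n)"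
      by (simp add: sum_negf sum_divide_distrib)
    also have "- (\<Sum>t\<in>I. u t * v t) = \<epsilon> * Suc n * X" using that by linarith
    finally show ?thesis using E by simp
  qed
  have pow: "DERIV (\<lambda>t. t ^ Suc n + s) t :> Suc n * t ^ n"
    "DERIV (\<lambda>t. s + t ^ Suc n) t :> Suc n * t ^ n" for s t :: real
    using DERIV_add[OF DERIV_pow[of "Suc n" t] DERIV_const[of s]]
      DERIV_add[OF DERIV_const[of s] DERIV_pow[of "Suc n" t]] by (simp_all del: power_Suc)
  have "DERIV (\<lambda>x. F (x, y)) x :> (\<Sum>i\<le>n. \<Sum>j\<le>n. c (i, j) * (i * x ^ (i - 1)) * y ^ j) + \<epsilon> * (Suc n * x ^ n)"
    unfolding F poly2_eval_def fst_conv snd_conv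
    by (intro DERIV_add DERIV_cmult pow) (auto intro!: derivative_eq_intros sum.cong)
  then have "(\<Sum>i\<le>n. \<Sum>j\<le>n. c (i, j) * (i * x ^ (i - 1)) * y ^ j) + \<epsilon> * (Suc n * x ^ n) = 0"
    using p ext by (intro DERIV_interior_extremum[where a = a and b = b]) (auto simp: xy)
  then show "fst p ^ n = (\<Sum>t\<in>{..n} \<times> {..n}. (- (c t * fst t) / (\<epsilon> * Suc n))
      * (fst p ^ (fst t - 1) * snd p ^ snd t))"
    by (intro solve) (simp add: xy sum.cartesian_product case_prod_unfold mult_ac)
  have "DERIV (\<lambda>y. F (x, y)) y :> (\<Sum>i\<le>n. \<Sum>j\<le>n. c (i, j) * x ^ i * (j * y ^ (j - 1))) + \<epsilon> * (Suc n * y ^ n)"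
    unfolding F poly2_eval_def fst_conv snd_conv
    by (intro DERIV_add DERIV_cmult pow) (auto intro!: derivative_eq_intros sum.cong)
  then have "(\<Sum>i\<le>n. \<Sum>j\<le>n. c (i, j) * x ^ i * (j * y ^ (j - 1))) + \<epsilon> * (Suc n * y ^ n) = 0"
    using p ext by (intro DERIV_interior_extremum[where a = e and b = h]) (auto simp: xy)
  then show "snd p ^ n = (\<Sum>t\<in>{..n} \<times> {..n}. (- (c t * snd t) / (\<epsilon> * Suc n))
      * (fst p ^ fst t * snd p ^ (snd t - 1)))"
    by (intro solve) (simp add: xy sum.cartesian_product case_prod_unfold mult_ac)
qed

section \<open>The number of cells met by a curve\<close>

text \<open>Restricted to the line, the polynomial is univariate of degree at most \<open>n\<close>.
  It is not identically zero, since otherwise the zero set would contain the line.\<close>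

lemma card_zeros_on_vertical_line:
  assumes "\<not> contains_axis_line (zero_set2 c n)"
  shows "finite {y. poly2_eval c n (x, y) = 0} \<and> card {y. poly2_eval c n (x, y) = 0} \<le> n"
proof -
  have eq: "poly2_eval c n (x, y) = (\<Sum>j\<le>n. (\<Sum>i\<le>n. c (i, j) * x ^ i) * y ^ j)" for y
    unfolding poly2_eval_def by (subst sum.swap) (simp add: sum_distrib_right)
  have "\<exists>y. poly2_eval c n (x, y) \<noteq> 0"
    using assms by (auto simp: contains_axis_line_def zero_set2_def)
  then have "\<exists>j\<le>n. (\<Sum>i\<le>n. c (i, j) * x ^ i) \<noteq> 0"
    unfolding eq by (metis (no_types, lifting) atMost_iff mult_zero_left sum.neutral)
  then show ?thesis unfolding eq by (intro polyfun_rootbound) auto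
qed

lemma card_zeros_on_horizontal_line:
  assumes "\<not> contains_axis_line (zero_set2 c n)"
  shows "finite {x. poly2_eval c n (x, y) = 0} \<and> card {x. poly2_eval c n (x, y) = 0} \<le> n"
proof -
  have eq: "poly2_eval c n (x, y) = (\<Sum>i\<le>n. (\<Sum>j\<le>n. c (i, j) * y ^ j) * x ^ i)" for x
    unfolding poly2_eval_def by (simp add: sum_distrib_left sum_distrib_right mult_ac)
  have "\<exists>x. poly2_eval c n (x, y) \<noteq> 0"
    using assms by (auto simp: contains_axis_line_def zero_set2_def)
  then have "\<exists>i\<le>n. (\<Sum>j\<le>n. c (i, j) * y ^ j) \<noteq> 0"
    unfolding eq by (metis (no_types, lifting) atMost_iff mult_zero_left sum.neutral)
  then show ?thesis unfolding eq by (intro polyfun_rootbound) auto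
qed

lemma card_zeros_on_lines:
  assumes "\<not> contains_axis_line (zero_set2 c n)" "finite X" "finite Y"
  defines "Z \<equiv> {p. poly2_eval c n p = 0 \<and> (fst p \<in> X \<or> snd p \<in> Y)}"
  shows "finite Z \<and> card Z \<le> (card X + card Y) * n"
proof -
  let ?V = "SIGMA x:X. {y. poly2_eval c n (x, y) = 0}"
  let ?H = "SIGMA y:Y. {x. poly2_eval c n (x, y) = 0}"
  note V = card_zeros_on_vertical_line[OF assms(1)] and H = card_zeros_on_horizontal_line[OF assms(1)]
  have fin: "finite ?V" "finite ?H" using V H assms by auto
  have "Z = ?V \<union> prod.swap ` ?H" by (force simp: Z_def image_iff)
  then have "finite Z" "card Z \<le> card ?V + card ?H"
    using fin card_Un_le[of ?V "prod.swap ` ?H"] by (auto simp: card_image)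
  moreover have "card ?V \<le> card X * n" "card ?H \<le> card Y * n"
    using V H assms sum_bounded_above[of X "\<lambda>x. card {y. poly2_eval c n (x, y) = 0}" n]
      sum_bounded_above[of Y "\<lambda>y. card {x. poly2_eval c n (x, y) = 0}" n] by auto
  ultimately show ?thesis by (simp add: add_mult_distrib)
qed

text \<open>Each such cell contains an interior extremum of one and the same perturbed polynomial.
  Disjoint cells give distinct extrema, and \<open>card_common_zeros_le\<close> bounds their
  number.\<close>

lemma card_cells_without_frame_zeros_le:
  fixes x0 x1 :: "'a \<Rightarrow> real" and y0 y1 :: "'b \<Rightarrow> real"
  assumes c: "poly2_deg_le c n" and "finite T"
    and disj: "pairwise (\<lambda>s t. disjnt ({x0 (fst s)..x1 (fst s)} \<times> {y0 (snd s)..y1 (snd s)})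
        ({x0 (fst t)..x1 (fst t)} \<times> {y0 (snd t)..y1 (snd t)})) T"
    and zero: "\<And>t. t \<in> T \<Longrightarrow>
      \<exists>z\<in>{x0 (fst t)..x1 (fst t)} \<times> {y0 (snd t)..y1 (snd t)}. poly2_eval c n z = 0"
    and frame: "\<And>t p. t \<in> T \<Longrightarrow> p \<in> {x0 (fst t), x1 (fst t)} \<times> {y0 (snd t)..y1 (snd t)}
      \<union> {x0 (fst t)..x1 (fst t)} \<times> {y0 (snd t), y1 (snd t)} \<Longrightarrow> poly2_eval c n p \<noteq> 0"
  shows "card T \<le> n\<^sup>2"
proof -
  let ?F = "\<lambda>\<epsilon> q. poly2_eval c n q + \<epsilon> * (fst q ^ Suc n + snd q ^ Suc n)"
  let ?R = "\<lambda>t. {x0 (fst t)..x1 (fst t)} \<times> {y0 (snd t)..y1 (snd t)}"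
  let ?I = "\<lambda>t. {x0 (fst t)<..<x1 (fst t)} \<times> {y0 (snd t)<..<y1 (snd t)}"
  have "\<forall>\<^sub>F \<epsilon> in at_right 0. \<forall>t\<in>T. \<exists>p\<in>?I t.
    (\<forall>q\<in>?R t. ?F \<epsilon> p \<le> ?F \<epsilon> q) \<or> (\<forall>q\<in>?R t. ?F \<epsilon> q \<le> ?F \<epsilon> p)"
  proof (intro eventually_ball_finite \<open>finite T\<close> ballI)
    fix t assume "t \<in> T"
    then obtain z where "z \<in> ?R t" "poly2_eval c n z = 0" using zero by blast
    then show "\<forall>\<^sub>F \<epsilon> in at_right 0. \<exists>p\<in>?I t.
      (\<forall>q\<in>?R t. ?F \<epsilon> p \<le> ?F \<epsilon> q) \<or> (\<forall>q\<in>?R t. ?F \<epsilon> q \<le> ?F \<epsilon> p)"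
      using frame[OF \<open>t \<in> T\<close>]
      by (intro perturbed_extremum_in_interior continuous_on_poly2_eval continuous_intros)
  qed
  then have "\<forall>\<^sub>F \<epsilon> in at_right 0. \<epsilon> > 0 \<and> (\<forall>t\<in>T. \<exists>p\<in>?I t.
    (\<forall>q\<in>?R t. ?F \<epsilon> p \<le> ?F \<epsilon> q) \<or> (\<forall>q\<in>?R t. ?F \<epsilon> q \<le> ?F \<epsilon> p))"
    using eventually_at_right_less[of "0::real"] by (rule eventually_conj[rotated])
  \<comment> \<open>As \<open>T\<close> is finite, a single \<open>\<epsilon>\<close> serves all
    cells, so the extrema satisfy a common pair of equations.\<close>
  then obtain \<epsilon> :: real where \<epsilon>: "\<epsilon> > 0" "\<forall>t\<in>T. \<exists>p\<in>?I t.
    (\<forall>q\<in>?R t. ?F \<epsilon> p \<le> ?F \<epsilon> q) \<or> (\<forall>q\<in>?R t. ?F \<epsilon> q \<le> ?F \<epsilon> p)"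
    using eventually_happens'[OF trivial_limit_at_right_real] by blast
  then obtain \<pi> where \<pi>: "\<And>t. t \<in> T \<Longrightarrow> \<pi> t \<in> ?I t"
    "\<And>t. t \<in> T \<Longrightarrow> (\<forall>q\<in>?R t. ?F \<epsilon> (\<pi> t) \<le> ?F \<epsilon> q) \<or> (\<forall>q\<in>?R t. ?F \<epsilon> q \<le> ?F \<epsilon> (\<pi> t))"
    by metis
  have "inj_on \<pi> T"
  proof (rule inj_onI, rule ccontr)
    fix s t assume st: "s \<in> T" "t \<in> T" "\<pi> s = \<pi> t" "s \<noteq> t"
    have "?I s \<subseteq> ?R s" "?I t \<subseteq> ?R t" by auto
    then have "\<pi> s \<in> ?R s" "\<pi> s \<in> ?R t" using \<pi>(1)[OF st(1)] \<pi>(1)[OF st(2)] st(3) by auto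
    then show False using pairwiseD[OF disj st(1,2,4)] by (meson disjnt_iff)
  qed
  then have "card T = card (\<pi> ` T)" by (simp add: card_image)
  also have "\<dots> \<le> n\<^sup>2"
  proof (rule card_common_zeros_le)
    fix p assume "p \<in> \<pi> ` T"
    then obtain t where t: "t \<in> T" "p = \<pi> t" by blast
    note eqs = perturbed_extremum_equations[where c = c and n = n, OF \<pi>(1)[OF t(1)] \<epsilon>(1) refl \<pi>(2)[OF t(1)], folded t(2)]
    show "fst p ^ n = (\<Sum>t\<in>{..n} \<times> {..n}. (- (c t * fst t) / (\<epsilon> * Suc n))
        * (fst p ^ (fst t - 1) * snd p ^ snd t))"
      and "snd p ^ n = (\<Sum>t\<in>{..n} \<times> {..n}. (- (c t * snd t) / (\<epsilon> * Suc n))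
        * (fst p ^ fst t * snd p ^ (snd t - 1)))"
      by (fact eqs)+
  next
    fix t :: "nat \<times> nat"
    have deg: "fst t + snd t \<le> n" if "c t \<noteq> 0"
      using c that unfolding poly2_deg_le_def by (metis not_le prod.collapse)
    \<comment> \<open>A nonzero coefficient forces the differentiated exponent to be positive, so
      the subtraction really lowers the degree.\<close>
    show "fst t - 1 + snd t < n" if "- (c t * fst t) / (\<epsilon> * Suc n) \<noteq> 0"
      using that deg by auto
    show "fst t + (snd t - 1) < n" if "- (c t * snd t) / (\<epsilon> * Suc n) \<noteq> 0"
      using that deg by auto
  qed (use \<open>finite T\<close> in auto)
  finally show ?thesis .
qed

text \<open>Cells with a zero on their boundary are charged to such a zero. These zeros lie on at
  most \<open>2 * card I\<close> vertical and \<open>2 * card J\<close> horizontal lines, with at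
  most \<open>n\<close> on each. The remaining cells number at most \<open>n^2\<close> by the
  perturbation argument.\<close>

lemma card_cells_met_le:
  fixes x0 x1 :: "'a \<Rightarrow> real" and y0 y1 :: "'b \<Rightarrow> real"
  assumes c: "poly2_deg_le c n" "\<not> contains_axis_line (zero_set2 c n)"
    and "finite I" "finite J"
    and I: "pairwise (\<lambda>i i'. disjnt {x0 i..x1 i} {x0 i'..x1 i'}) I"
    and J: "pairwise (\<lambda>j j'. disjnt {y0 j..y1 j} {y0 j'..y1 j'}) J"
    and T: "T \<subseteq> I \<times> J"
    and zero: "\<And>i j. (i, j) \<in> T \<Longrightarrow> \<exists>z\<in>{x0 i..x1 i} \<times> {y0 j..y1 j}. poly2_eval c n z = 0"
  shows "card T \<le> 2 * (card I + card J) * n + n\<^sup>2"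
proof -
  let ?R = "\<lambda>t. {x0 (fst t)..x1 (fst t)} \<times> {y0 (snd t)..y1 (snd t)}"
  let ?B = "\<lambda>t. {x0 (fst t), x1 (fst t)} \<times> {y0 (snd t)..y1 (snd t)}
      \<union> {x0 (fst t)..x1 (fst t)} \<times> {y0 (snd t), y1 (snd t)}"
  have finT: "finite T" using T \<open>finite I\<close> \<open>finite J\<close> by (meson finite_SigmaI finite_subset)
  have disj: "disjnt (?R s) (?R t)" if "s \<in> T" "t \<in> T" "s \<noteq> t" for s t
  proof -
    have "fst s \<in> I" "fst t \<in> I" "snd s \<in> J" "snd t \<in> J" using T that by auto
    moreover have "fst s \<noteq> fst t \<or> snd s \<noteq> snd t" using that by (simp add: prod_eq_iff)
    ultimately show ?thesis
      using pairwiseD[OF I, of "fst s" "fst t"] pairwiseD[OF J, of "snd s" "snd t"]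
      by (simp only: disjnt_Times1_iff disjnt_def Times_Int_Times Times_empty) blast
  qed
  define T1 where "T1 = {t\<in>T. \<exists>p\<in>?B t. poly2_eval c n p = 0}"
  define X where "X = x0 ` I \<union> x1 ` I"
  define Y where "Y = y0 ` J \<union> y1 ` J"
  define Z where "Z = {p. poly2_eval c n p = 0 \<and> (fst p \<in> X \<or> snd p \<in> Y)}"
  have XY: "finite X" "finite Y" "card X \<le> 2 * card I" "card Y \<le> 2 * card J"
    using \<open>finite I\<close> \<open>finite J\<close> card_Un_le[of "x0 ` I" "x1 ` I"] card_image_le[of I x0] card_image_le[of I x1]
      card_Un_le[of "y0 ` J" "y1 ` J"] card_image_le[of J y0] card_image_le[of J y1]
    by (auto simp: X_def Y_def)
  have Z: "finite Z" "card Z \<le> (card X + card Y) * n"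
    using card_zeros_on_lines[OF c(2) XY(1,2)] by (auto simp: Z_def)
  have "\<forall>t\<in>T1. \<exists>p. p \<in> ?B t \<and> poly2_eval c n p = 0" unfolding T1_def by blast
  then obtain \<zeta> where \<zeta>: "\<And>t. t \<in> T1 \<Longrightarrow> \<zeta> t \<in> ?B t" "\<And>t. t \<in> T1 \<Longrightarrow> poly2_eval c n (\<zeta> t) = 0"
    by metis
  have "inj_on \<zeta> T1"
  proof (rule inj_onI, rule ccontr)
    fix s t assume st: "s \<in> T1" "t \<in> T1" "\<zeta> s = \<zeta> t" "s \<noteq> t"
    \<comment> \<open>For an empty rectangle the points of \<open>?B t\<close> need not lie in
      \<open>?R t\<close>; the zero in the cell excludes this case.\<close>
    have R: "?B t \<subseteq> ?R t" if "t \<in> T1" for t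
    proof -
      have "?R t \<noteq> {}" using zero[of "fst t" "snd t"] that by (auto simp: T1_def)
      then show ?thesis by (auto simp: Times_empty)
    qed
    have "\<zeta> s \<in> ?R s" "\<zeta> s \<in> ?R t"
      using subsetD[OF R[OF st(1)] \<zeta>(1)[OF st(1)]] subsetD[OF R[OF st(2)] \<zeta>(1)[OF st(2)]] st(3)
      by simp_all
    moreover have "disjnt (?R s) (?R t)" using st by (intro disj) (auto simp: T1_def)
    ultimately show False by (meson disjnt_iff)
  qed
  moreover have "\<zeta> ` T1 \<subseteq> Z"
  proof
    fix p assume "p \<in> \<zeta> ` T1"
    then obtain t where t: "t \<in> T1" "p = \<zeta> t" by blast
    have "fst t \<in> I" "snd t \<in> J" using T t by (auto simp: T1_def)
    then show "p \<in> Z" using \<zeta>[OF t(1)] t(2) by (auto simp: Z_def X_def Y_def)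
  qed
  ultimately have "card T1 \<le> card Z" using Z by (metis card_inj_on_le)
  also have "\<dots> \<le> (2 * card I + 2 * card J) * n"
    using Z(2) XY(3,4) by (meson add_mono le_trans mult_le_mono1)
  finally have 1: "card T1 \<le> 2 * (card I + card J) * n" by simp
  have 2: "card (T - T1) \<le> n\<^sup>2"
  proof (rule card_cells_without_frame_zeros_le[OF c(1), of _ x0 x1 y0 y1])
    show "finite (T - T1)" using finT by simp
    show "pairwise (\<lambda>s t. disjnt (?R s) (?R t)) (T - T1)" using disj by (simp add: pairwise_def)
    show "\<exists>z\<in>?R t. poly2_eval c n z = 0" if "t \<in> T - T1" for t
      using zero[of "fst t" "snd t"] that by simp
    show "poly2_eval c n p \<noteq> 0" if "t \<in> T - T1" "p \<in> ?B t" for t p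
      using that unfolding T1_def by blast
  qed
  have "card T = card T1 + card (T - T1)"
    using finT by (simp add: T1_def card_Diff_subset card_mono)
  with 1 2 show ?thesis by linarith
qed

section \<open>The incidence bound on the grid and the choice of the number of blocks\<close>

lemma disjnt_ordered_intervals:
  fixes lo hi :: "nat \<Rightarrow> real"
  assumes "\<And>i j. i \<in> I \<Longrightarrow> j \<in> I \<Longrightarrow> i < j \<Longrightarrow> hi i < lo j"
  shows "pairwise (\<lambda>i j. disjnt {lo i..hi i} {lo j..hi j}) I"
proof (rule pairwiseI)
  fix i j assume ij: "i \<in> I" "j \<in> I" "i \<noteq> j"
  then consider "hi i < lo j" | "hi j < lo i" using assms by (meson linorder_neqE_nat)
  then show "disjnt {lo i..hi i} {lo j..hi j}" by cases (auto simp: disjnt_iff)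
qed

text \<open>The cells are products of blocks of \<open>A\<close> and \<open>B\<close>. The bounds on
  cells met by a curve and on points per cell enter the double count
  \<open>incidences_le_cells\<close>; \<open>k\<close> stays free, to be optimised in the
  theorem.\<close>

lemma incidences_grid_le:
  assumes "finite A" "finite B" "finite \<C>"
    and deg: "\<And>C. C \<in> \<C> \<Longrightarrow> alg_curve_deg_le d C"
    and M: "\<And>p q. p \<in> A \<times> B \<Longrightarrow> q \<in> A \<times> B \<Longrightarrow> p \<noteq> q \<Longrightarrow> card {C\<in>\<C>. p \<in> C \<and> q \<in> C} \<le> M"
    and axis: "\<And>C. C \<in> \<C> \<Longrightarrow> \<not> contains_axis_line C"
    and k: "1 \<le> k" "k \<le> card A" "k \<le> card B"
  shows "real (card (incidences (A \<times> B) \<C>))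
    \<le> real (4 * k * d + d\<^sup>2) * card \<C> + 4 * real M * real (card (A \<times> B)) ^ 2 / real k ^ 2"
proof -
  obtain \<kappa> lo hi where \<kappa>: "\<kappa> ` A \<subseteq> {..<k}"
    "\<And>a. a \<in> A \<Longrightarrow> lo (\<kappa> a) \<le> a \<and> a \<le> hi (\<kappa> a)"
    "\<And>i j. i \<in> \<kappa> ` A \<Longrightarrow> j \<in> \<kappa> ` A \<Longrightarrow> i < j \<Longrightarrow> hi i < (lo j :: real)"
    "\<And>i. card {a\<in>A. \<kappa> a = i} * k \<le> 2 * card A"
    by (rule order_convex_partition[OF \<open>finite A\<close> k(1,2)]) blast
  obtain \<kappa>' lo' hi' where \<kappa>': "\<kappa>' ` B \<subseteq> {..<k}"
    "\<And>a. a \<in> B \<Longrightarrow> lo' (\<kappa>' a) \<le> a \<and> a \<le> hi' (\<kappa>' a)"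
    "\<And>i j. i \<in> \<kappa>' ` B \<Longrightarrow> j \<in> \<kappa>' ` B \<Longrightarrow> i < j \<Longrightarrow> hi' i < (lo' j :: real)"
    "\<And>i. card {a\<in>B. \<kappa>' a = i} * k \<le> 2 * card B"
    by (rule order_convex_partition[OF \<open>finite B\<close> k(1,3)]) blast
  \<comment> \<open>Blocks have at most \<open>2 * card A / k\<close> and
    \<open>2 * card B / k\<close> points, and cell sizes are integers, so rounding down is
    allowed.\<close>
  define L where "L = 4 * card (A \<times> B) div k\<^sup>2"
  have "card (incidences (A \<times> B) \<C>)
    \<le> (4 * k * d + d\<^sup>2) * card \<C> + M * (card (A \<times> B) * L)"
  proof (rule incidences_le_cells)
    fix C assume C: "C \<in> \<C>"
    obtain c where c: "poly2_deg_le c d" "C = zero_set2 c d"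
      using deg[OF C] by (auto simp: alg_curve_deg_le_def)
    have "card (map_prod \<kappa> \<kappa>' ` (A \<times> B \<inter> C))
      \<le> 2 * (card (\<kappa> ` A) + card (\<kappa>' ` B)) * d + d\<^sup>2"
    proof (rule card_cells_met_le[OF c(1), of _ _ lo hi lo' hi'])
      show "\<not> contains_axis_line (zero_set2 c d)" using axis[OF C] c by simp
      show "\<exists>z\<in>{lo i..hi i} \<times> {lo' j..hi' j}. poly2_eval c d z = 0"
        if "(i, j) \<in> map_prod \<kappa> \<kappa>' ` (A \<times> B \<inter> C)" for i j
      proof -
        obtain a b where ab: "a \<in> A" "b \<in> B" "(a, b) \<in> C" "i = \<kappa> a" "j = \<kappa>' b"
          using \<open>(i, j) \<in> map_prod \<kappa> \<kappa>' ` (A \<times> B \<inter> C)\<close> by auto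
        then have "(a, b) \<in> {lo i..hi i} \<times> {lo' j..hi' j}" using \<kappa>(2) \<kappa>'(2) by simp
        moreover have "poly2_eval c d (a, b) = 0" using ab(3) by (simp add: c(2) zero_set2_def)
        ultimately show ?thesis by blast
      qed
    qed (use assms \<kappa>(3) \<kappa>'(3) in \<open>auto intro!: disjnt_ordered_intervals\<close>)
    also have "\<dots> \<le> 2 * (k + k) * d + d\<^sup>2"
      using card_mono[OF _ \<kappa>(1)] card_mono[OF _ \<kappa>'(1)]
      by (intro add_right_mono mult_le_mono1 mult_le_mono2 add_mono) simp_all
    finally show "card (map_prod \<kappa> \<kappa>' ` (A \<times> B \<inter> C)) \<le> 4 * k * d + d\<^sup>2" by simp
  next
    fix t :: "nat \<times> nat"
    let ?a = "card {a\<in>A. \<kappa> a = fst t}" and ?b = "card {b\<in>B. \<kappa>' b = snd t}"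
    have "{p \<in> A \<times> B. map_prod \<kappa> \<kappa>' p = t} = {a\<in>A. \<kappa> a = fst t} \<times> {b\<in>B. \<kappa>' b = snd t}"
      by auto
    then have "card {p \<in> A \<times> B. map_prod \<kappa> \<kappa>' p = t} = ?a * ?b" by (simp add: card_cartesian_product)
    moreover have "?a * ?b * k\<^sup>2 \<le> 4 * card (A \<times> B)"
      using mult_le_mono[OF \<kappa>(4)[of "fst t"] \<kappa>'(4)[of "snd t"]]
      by (simp add: card_cartesian_product power2_eq_square mult_ac)
    ultimately show "card {p \<in> A \<times> B. map_prod \<kappa> \<kappa>' p = t} \<le> L"
      using k(1) by (simp add: L_def less_eq_div_iff_mult_less_eq)
  qed (use assms in auto)
  then have "real (card (incidences (A \<times> B) \<C>))
    \<le> real ((4 * k * d + d\<^sup>2) * card \<C> + M * (card (A \<times> B) * L))"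
    by (simp only: of_nat_le_iff)
  also have "\<dots> = real (4 * k * d + d\<^sup>2) * card \<C> + M * card (A \<times> B) * real L" by simp
  also have "\<dots> \<le> real (4 * k * d + d\<^sup>2) * card \<C> + M * card (A \<times> B) * (real (4 * card (A \<times> B)) / real (k\<^sup>2))"
    unfolding L_def by (intro add_mono mult_left_mono of_nat_div_le_of_nat) auto
  also have "M * card (A \<times> B) * (real (4 * card (A \<times> B)) / real (k\<^sup>2)) = 4 * real M * real (card (A \<times> B)) ^ 2 / real k ^ 2"
    by (simp add: power2_eq_square)
  finally show ?thesis .
qed

theorem theorem2p1:
  shows "\<exists>K::real. \<forall>(A::real set) (B::real set) (d::nat) (M::nat) (\<C>::(real \<times> real) set set).
     finite A \<and> finite B \<and> d \<ge> 1 \<and> M \<ge> 1 \<and> finite \<C> \<and>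
     (\<forall>C\<in>\<C>. alg_curve_deg_le d C) \<and>
     (\<forall>p\<in>A \<times> B. \<forall>q\<in>A \<times> B. p \<noteq> q \<longrightarrow> card {C\<in>\<C>. p \<in> C \<and> q \<in> C} \<le> M) \<and>
     (\<forall>C\<in>\<C>. \<not> contains_axis_line C) \<and>
     real d ^ 4 * real (card \<C>) \<le> real M * real (card (A \<times> B)) ^ 2 \<and>
     card A \<le> card B \<and>
     real d * real (card \<C>) \<ge> real M * real (card B) ^ 2 / real (card A)
     \<longrightarrow> real (card (incidences (A \<times> B) \<C>)) \<le>
         K * real d powr (2/3) * real M powr (1/3) * real (card (A \<times> B)) powr (2/3)
           * real (card \<C>) powr (2/3)"
\<comment> \<open>The constant is 5 + 16: the first summand comes from the cells met by the curves,
  the second from the pairs inside cells.\<close>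
proof (rule exI[of _ 21], intro allI impI, elim conjE)
  fix A B :: "real set" and d M :: nat and \<C> :: "(real \<times> real) set set"
  assume fin: "finite A" "finite B" "finite \<C>" and d: "1 \<le> d" and M: "1 \<le> M"
    and deg: "\<forall>C\<in>\<C>. alg_curve_deg_le d C"
    and pairs: "\<forall>p\<in>A \<times> B. \<forall>q\<in>A \<times> B. p \<noteq> q \<longrightarrow> card {C\<in>\<C>. p \<in> C \<and> q \<in> C} \<le> M"
    and axis: "\<forall>C\<in>\<C>. \<not> contains_axis_line C"
    and d4: "real d ^ 4 * real (card \<C>) \<le> real M * real (card (A \<times> B)) ^ 2"
    and AB: "card A \<le> card B"
    and many: "real M * real (card B) ^ 2 / real (card A) \<le> real d * real (card \<C>)"
  let ?rhs = "21 * real d powr (2/3) * real M powr (1/3) * real (card (A \<times> B)) powr (2/3)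
    * real (card \<C>) powr (2/3)"
  show "real (card (incidences (A \<times> B) \<C>)) \<le> ?rhs"
  \<comment> \<open>The balancing value \<open>r\<close> below needs both the number of points and
    the number of curves to be positive.\<close>
  proof (cases "A \<times> B = {} \<or> \<C> = {}")
    case True
    then have "incidences (A \<times> B) \<C> = {}" unfolding incidences_def by auto
    then show ?thesis by simp
  next
    case False
    define P N a b where "P = real (card (A \<times> B))" and "N = real (card \<C>)"
      and "a = real (card A)" and "b = real (card B)"
    have pos: "P > 0" "N > 0" "a > 0" "b > 0" "real d > 0" "real M > 0"
      using False fin d M by (auto simp: P_def N_def a_def b_def card_gt_0_iff)
    have P: "P = a * b" by (simp add: P_def a_def b_def card_cartesian_product)
    \<comment> \<open>This real value of \<open>k\<close> makes \<open>d * N * k\<close> equal to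
      \<open>M * P^2 / k^2\<close>; the common value is \<open>T\<close> below.\<close>
    define r where "r = (M * P\<^sup>2 / (d * N)) powr (1/3)"
    have r: "r > 0" "r ^ 3 = M * P\<^sup>2 / (d * N)"
      using pos by (simp_all add: r_def powr_power)
    have "real d ^ 3 \<le> r ^ 3"
      unfolding r(2) using d4 pos
      by (subst pos_le_divide_eq) (simp_all add: P_def N_def eval_nat_numeral mult_ac)
    then have dr: "real d \<le> r" using r(1) power_mono_iff[of "real d" r 3] by simp
    \<comment> \<open>Multiplied by \<open>a^2\<close>, the lower bound on the number of curves
      becomes \<open>r^3 \<le> a^3\<close>, since \<open>P = a * b\<close>.\<close>
    have "M * b\<^sup>2 \<le> d * N * a"
      using many pos by (simp add: field_simps a_def b_def N_def)
    from mult_right_mono[OF this, of "a\<^sup>2"] have "r ^ 3 \<le> a ^ 3"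
      unfolding r(2) using pos
      by (subst pos_divide_le_eq) (simp_all add: P eval_nat_numeral mult_ac)
    then have ra: "r \<le> a" using r(1) pos power_mono_iff[of r a 3] by simp
    define k where "k = nat \<lfloor>r\<rfloor>"
    have dk: "d \<le> k" using dr by (simp add: k_def le_nat_floor)
    have kr: "real k \<le> r" using r by (simp add: k_def)
    \<comment> \<open>Rounding down loses at most a factor 2, as \<open>r < k + 1\<close> and
      \<open>k\<close> is at least 1.\<close>
    have rk: "r \<le> 2 * k" using dk d r unfolding k_def by linarith
    have k1: "1 \<le> k" using dk d by simp
    have ka: "k \<le> card A" using kr ra by (simp add: a_def)
    define T where "T = d * N * r"
    have T: "M * P\<^sup>2 / r\<^sup>2 = T"
    proof -
      have "M * P\<^sup>2 = r ^ 3 * (d * N)" using r pos by simp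
      then have "M * P\<^sup>2 / r\<^sup>2 = r ^ 3 * (d * N) / r\<^sup>2" by (rule arg_cong)
      also have "\<dots> = T"
        using r(1) by (simp add: T_def power3_eq_cube power2_eq_square)
      finally show ?thesis .
    qed
    have "real (card (incidences (A \<times> B) \<C>)) \<le> real (4 * k * d + d\<^sup>2) * N + 4 * real M * P\<^sup>2 / real k ^ 2"
      unfolding N_def P_def
    proof (rule incidences_grid_le[OF fin])
      show "k \<le> card B" using ka AB by linarith
    qed (use deg pairs axis k1 ka in blast)+
    also have "\<dots> \<le> 5 * T + 16 * T"
    proof (rule add_mono)
      have "4 * k * d + d\<^sup>2 \<le> 5 * k * d" using dk by (simp add: power2_eq_square)
      then have "real (4 * k * d + d\<^sup>2) \<le> real (5 * k * d)" by (simp only: of_nat_le_iff)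
      also have "\<dots> \<le> 5 * r * d" using kr by (simp add: mult_right_mono)
      finally have "real (4 * k * d + d\<^sup>2) * N \<le> 5 * r * d * N"
        using pos by (intro mult_right_mono) auto
      then show "real (4 * k * d + d\<^sup>2) * N \<le> 5 * T" by (simp add: T_def mult_ac)
      \<comment> \<open>Replacing \<open>k\<close> by \<open>r / 2\<close> in the denominator turns
        the factor 4 into 16.\<close>
      have "4 * real M * P\<^sup>2 / real k ^ 2 \<le> 4 * real M * P\<^sup>2 / (r / 2) ^ 2"
        using rk k1 r(1) pos by (intro divide_left_mono power_mono mult_pos_pos) auto
      also have "\<dots> = 16 * (M * P\<^sup>2 / r\<^sup>2)" by (simp add: power_divide)
      also have "\<dots> = 16 * T" by (simp only: T)
      finally show "4 * real M * P\<^sup>2 / real k ^ 2 \<le> 16 * T" .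
    qed
    also have "\<dots> = 21 * T" by simp
    also have "T = d powr (2/3) * M powr (1/3) * P powr (2/3) * N powr (2/3)"
    proof -
      \<comment> \<open>The explicit factor \<open>d * N\<close> and its power -1/3 inside
        \<open>r\<close> combine to the exponent 2/3.\<close>
      have "T = (d * N) powr 1 * (M powr (1/3) * P powr (2/3) / (d * N) powr (1/3))"
        using pos powr_powr[of P 2 "1/3"] by (simp add: T_def r_def powr_mult powr_divide)
      also have "\<dots> = (d * N) powr (2/3) * (M powr (1/3) * P powr (2/3))"
        using pos powr_diff[of "d * N" 1 "1/3"] by simp
      finally show ?thesis using pos by (simp add: powr_mult)
    qed
    finally show ?thesis by (simp add: P_def N_def mult_ac)
  qed
qed

end
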